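(* Let $S$ be a discrete semigroup, let $T$ be a closed subsemigroup of $\beta S$, let $\mathcal{F}$ be a filter on $S$ such that $\overline{\mathcal{F}}=T$, and let $A\subseteq S$. Consider the following statements. (a) $A$ is $\mathcal{F}$-quasi-central. (b) There is an $FS$-tree $\mathcal{T}$ in $A$ such that for each $F\in\mathcal{P}_f(\mathcal{T})$, $\bigcap_{f\in F}B_f$ is piecewise $\mathcal{F}$-syndetic. (c) There is a $\ast$-tree $\mathcal{T}$ in $A$ such that for each $F\in\mathcal{P}_f(\mathcal{T})$, $\bigcap_{f\in F}B_f$ is piecewise $\mathcal{F}$-syndetic. (d) There is a downward directed family $\langle C_F\rangle_{F\in I}$ of subsets of $A$ such that (i) for each $F\in I$ and each $x\in C_F$ there exists $G\in I$ with $C_G\subseteq x^{-1}C_F$, and (ii) for each $F\in I$, $C_F$ is piecewise $\mathcal{F}$-syndetic. (e) There is a decreasing sequence $\langle C_n\rangle_{n=1}^{\infty}$ of subsets of $A$ such that (i) for each $n\in\mathbb{N}$ and each $x\in C_n$ there exists $m\in\mathbb{N}$ with $C_m\subseteq x^{-1}C_n$, and (ii) for each $n\in\mathbb{N}$, $C_n$ is piecewise $\mathcal{F}$-syndetic. Then (a), (b), (c) and (d) are equivalent and are implied by (e). If $S$ is countable, all five statements are equivalent.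
   Context: $\beta S$ is the space of ultrafilters on $S$. For $x\in S$, $A,G\subseteq S$ put $x^{-1}A=\{y\in S: xy\in A\}$ and $G^{-1}A=\bigcup_{x\in G}x^{-1}A$. The operation on $\beta S$: $A\in p\cdot q$ iff $\{x\in S: x^{-1}A\in q\}\in p$. $\overline{\mathcal{F}}=\{p\in\beta S:\mathcal{F}\subseteq p\}$. A closed subsemigroup is nonempty; $K(T)$ is the smallest two-sided ideal of the compact right topological semigroup $T$. $\mathcal{P}_f(Y)$ is the set of finite nonempty subsets of $Y$. $A\subseteq S$ is $\mathcal{F}$-quasi-central if there is an idempotent $p$ in the closure $cl\,K(\overline{\mathcal{F}})$ with $A\in p$. $A\subseteq S$ is piecewise $\mathcal{F}$-syndetic if for every $V\in\mathcal{F}$ there are a finite $F_V\subseteq V$ and $W_V\in\mathcal{F}$ such that the family $\{(x^{-1}F_V^{-1}A)\cap V: V\in\mathcal{F},\ x\in W_V\}$ has the finite intersection property. Let $\omega=\{0,1,2,\dots\}$, each $n\in\omega$ being identified with $\{0,\dots,n-1\}$. $\mathcal{T}$ is a tree in $A$ if $\mathcal{T}$ is a nonempty set of functions such that for each $f\in\mathcal{T}$, $\mathrm{domain}(f)\in\omega$, $\mathrm{range}(f)\subseteq A$, and if $\mathrm{domain}(f)=n>0$ then $f|_{n-1}\in\mathcal{T}$. If $f$ is a function with $\mathrm{domain}(f)=n\in\omega$, then $f\frown x=f\cup\{(n,x)\}$. For a tree $\mathcal{T}$ and $f\in\mathcal{T}$, $B_f=B_f(\mathcal{T})=\{x: f\frown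 x\in\mathcal{T}\}$. $\mathcal{T}$ is a $\ast$-tree in $A$ if it is a tree in $A$ and for all $f\in\mathcal{T}$ and all $x\in B_f$, $B_{f\frown x}\subseteq x^{-1}B_f$. $\mathcal{T}$ is an $FS$-tree in $A$ if it is a tree in $A$ and for all $f\in\mathcal{T}$, $B_f=\{\prod_{t\in F}g(t): g\in\mathcal{T},\ f\subseteq g,\ \emptyset\neq F\subseteq\mathrm{domain}(g)\setminus\mathrm{domain}(f)\}$, with products taken in increasing order of indices. A family $\langle C_F\rangle_{F\in I}$ (with $I\ne\emptyset$) is downward directed if for all $F,G\in I$ there is $H\in I$ with $C_H\subseteq C_F\cap C_G$. *)

theory Defs
  imports "HOL-Analysis.Analysis" "HOL-Library.Sublist"
begin

section \<open>Filters and ultrafilters on a discrete semigroup\<close>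

text \<open>
  The semigroup is the whole of a type \<open>'a :: semigroup_mult\<close>. Filters are the library type
  \<open>'a filter\<close>; its bottom element is the improper filter, so a filter in the usual sense is one
  different from \<open>bot\<close>. The library orders filters by refinement: \<open>p \<le> \<F>\<close> says that every member
  of \<open>\<F>\<close> is a member of \<open>p\<close>.
\<close>

abbreviation filter_mem :: "'a set \<Rightarrow> 'a filter \<Rightarrow> bool"  (infix "\<in>\<^sub>F" 50)
  where "A \<in>\<^sub>F F \<equiv> (\<forall>\<^sub>F x in F. x \<in> A)"

lemma filter_le_iff_mem: "p \<le> F \<longleftrightarrow> (\<forall>A. A \<in>\<^sub>F F \<longrightarrow> A \<in>\<^sub>F p)"
proof
  assume "\<forall>A. A \<in>\<^sub>F F \<longrightarrow> A \<in>\<^sub>F p"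
  then have "eventually P F \<longrightarrow> eventually P p" for P
    by (auto dest: spec[of _ "Collect P"])
  then show "p \<le> F"
    by (simp add: le_filter_def)
qed (simp add: le_filter_def)

definition ultrafilter :: "'a filter \<Rightarrow> bool"
  where "ultrafilter p \<longleftrightarrow> p \<noteq> bot \<and> (\<forall>A. A \<in>\<^sub>F p \<or> - A \<in>\<^sub>F p)"

definition beta_topology :: "'a filter topology"
  where "beta_topology = topology_generated_by {{p. ultrafilter p \<and> A \<in>\<^sub>F p} | A. True}"

lemma topspace_beta_topology: "topspace beta_topology = Collect ultrafilter"
proof -
  have "Collect ultrafilter \<in> {{p. ultrafilter p \<and> A \<in>\<^sub>F p} | A. True}"
    by (rule CollectI, rule exI[of _ UNIV]) simp
  then have "\<Union> {{p. ultrafilter p \<and> A \<in>\<^sub>F p} | A. True} = Collect ultrafilter"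
    by blast
  then show ?thesis
    by (simp add: beta_topology_def topology_generated_by_topspace)
qed

definition left_quot :: "'a::semigroup_mult \<Rightarrow> 'a set \<Rightarrow> 'a set"
  where "left_quot x A = {y. x * y \<in> A}"

definition left_quot_set :: "'a::semigroup_mult set \<Rightarrow> 'a set \<Rightarrow> 'a set"
  where "left_quot_set G A = (\<Union>x\<in>G. left_quot x A)"

definition beta_mult :: "'a::semigroup_mult filter \<Rightarrow> 'a filter \<Rightarrow> 'a filter"  (infixl "\<odot>" 70)
  where "p \<odot> q = Abs_filter (\<lambda>P. \<forall>\<^sub>F x in p. \<forall>\<^sub>F y in q. P (x * y))"

lemma eventually_beta_mult:
  "eventually P (p \<odot> q) \<longleftrightarrow> (\<forall>\<^sub>F x in p. \<forall>\<^sub>F y in q. P (x * y))"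
  unfolding beta_mult_def
proof (rule eventually_Abs_filter, rule is_filter.intro, goal_cases)
  case 1
  show ?case by simp
next
  case (2 P Q)
  then show ?case by eventually_elim (rule eventually_conj)
next
  case (3 P Q)
  from 3(2) show ?case
    by eventually_elim (use 3(1) in \<open>auto elim: eventually_mono\<close>)
qed

lemma mem_beta_mult_iff: "A \<in>\<^sub>F p \<odot> q \<longleftrightarrow> {x. left_quot x A \<in>\<^sub>F q} \<in>\<^sub>F p"
  by (simp add: eventually_beta_mult left_quot_def)

definition filter_closure :: "'a filter \<Rightarrow> 'a filter set"
  where "filter_closure F = {p. ultrafilter p \<and> p \<le> F}"

definition closed_subsemigroup :: "'a::semigroup_mult filter set \<Rightarrow> bool"
  where "closed_subsemigroup T \<longleftrightarrow>
    T \<noteq> {} \<and> closedin beta_topology T \<and> (\<forall>p\<in>T. \<forall>q\<in>T. p \<odot> q \<in> T)"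

definition two_sided_ideal :: "'a::semigroup_mult filter set \<Rightarrow> 'a filter set \<Rightarrow> bool"
  where "two_sided_ideal T J \<longleftrightarrow>
    J \<noteq> {} \<and> J \<subseteq> T \<and> (\<forall>p\<in>T. \<forall>q\<in>J. p \<odot> q \<in> J \<and> q \<odot> p \<in> J)"

text \<open>Meaningful only when \<open>T\<close> has a smallest ideal, e.g.\ for closed subsemigroups.\<close>

definition smallest_ideal :: "'a::semigroup_mult filter set \<Rightarrow> 'a filter set"
  where "smallest_ideal T = (LEAST J. two_sided_ideal T J)"


section \<open>Notions of size\<close>

definition quasi_central :: "'a::semigroup_mult filter \<Rightarrow> 'a set \<Rightarrow> bool"
  where "quasi_central F A \<longleftrightarrow>
    (\<exists>p \<in> beta_topology closure_of smallest_ideal (filter_closure F). p \<odot> p = p \<and> A \<in>\<^sub>F p)"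

definition fip :: "'a set set \<Rightarrow> bool"
  where "fip \<A> \<longleftrightarrow> (\<forall>\<B>\<subseteq>\<A>. finite \<B> \<and> \<B> \<noteq> {} \<longrightarrow> \<Inter>\<B> \<noteq> {})"

definition piecewise_syndetic :: "'a::semigroup_mult filter \<Rightarrow> 'a set \<Rightarrow> bool"
  where "piecewise_syndetic F A \<longleftrightarrow>
    (\<exists>G W :: 'a set \<Rightarrow> 'a set.
       (\<forall>V. V \<in>\<^sub>F F \<longrightarrow> finite (G V) \<and> G V \<subseteq> V \<and> W V \<in>\<^sub>F F) \<and>
       fip {left_quot x (left_quot_set (G V) A) \<inter> V | V x. V \<in>\<^sub>F F \<and> x \<in> W V})"


section \<open>Trees\<close>

text \<open>
  A function with domain \<open>n = {0,\<dots>,n-1}\<close> is represented by the list of its values, of length \<open>n\<close>.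
  Restriction to \<open>n - 1\<close> is \<^const>\<open>butlast\<close>, inclusion of functions is \<^const>\<open>prefix\<close>, and
  \<open>f \<frown> x\<close> is \<open>f @ [x]\<close>.
\<close>

definition tree_in :: "'a set \<Rightarrow> 'a list set \<Rightarrow> bool"
  where "tree_in A T \<longleftrightarrow>
    T \<noteq> {} \<and> (\<forall>f\<in>T. set f \<subseteq> A \<and> (f \<noteq> [] \<longrightarrow> butlast f \<in> T))"

definition succs :: "'a list set \<Rightarrow> 'a list \<Rightarrow> 'a set"
  where "succs T f = {x. f @ [x] \<in> T}"

definition star_tree_in :: "'a::semigroup_mult set \<Rightarrow> 'a list set \<Rightarrow> bool"
  where "star_tree_in A T \<longleftrightarrow> tree_in A T \<and>
    (\<forall>f\<in>T. \<forall>x\<in>succs T f. succs T (f @ [x]) \<subseteq> left_quot x (succs T f))"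

text \<open>Product of a nonempty list, in list order; unspecified on the empty list, as there need be
  no unit.\<close>

primrec semigroup_prod :: "'a::semigroup_mult list \<Rightarrow> 'a"
  where "semigroup_prod (x # xs) = (if xs = [] then x else x * semigroup_prod xs)"

definition FS_tree_in :: "'a::semigroup_mult set \<Rightarrow> 'a list set \<Rightarrow> bool"
  where "FS_tree_in A T \<longleftrightarrow> tree_in A T \<and>
    (\<forall>f\<in>T. succs T f =
       {semigroup_prod (map (\<lambda>t. g ! t) (sorted_list_of_set H)) | g H.
          g \<in> T \<and> prefix f g \<and> H \<noteq> {} \<and> H \<subseteq> {..<length g} - {..<length f}})"

definition succs_piecewise_syndetic :: "'a::semigroup_mult filter \<Rightarrow> 'a list set \<Rightarrow> bool"
  where "succs_piecewise_syndetic F T \<longleftrightarrow>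
    (\<forall>H. finite H \<and> H \<noteq> {} \<and> H \<subseteq> T \<longrightarrow> piecewise_syndetic F (\<Inter>f\<in>H. succs T f))"


section \<open>Directed families\<close>

definition downward_directed :: "'i set \<Rightarrow> ('i \<Rightarrow> 'a set) \<Rightarrow> bool"
  where "downward_directed I C \<longleftrightarrow>
    I \<noteq> {} \<and> (\<forall>i\<in>I. \<forall>j\<in>I. \<exists>k\<in>I. C k \<subseteq> C i \<inter> C j)"

definition good_family ::
    "'a::semigroup_mult filter \<Rightarrow> 'a set \<Rightarrow> 'i set \<Rightarrow> ('i \<Rightarrow> 'a set) \<Rightarrow> bool"
  where "good_family F A I C \<longleftrightarrow>
    downward_directed I C \<and>
    (\<forall>i\<in>I. C i \<subseteq> A) \<and>
    (\<forall>i\<in>I. \<forall>x\<in>C i. \<exists>j\<in>I. C j \<subseteq> left_quot x (C i)) \<and>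
    (\<forall>i\<in>I. piecewise_syndetic F (C i))"

text \<open>
  An existential quantifier cannot range over index types, so the existence of a good family is
  stated with index set in \<open>'a set set\<close>. This loses nothing: a family indexed by an arbitrary type
  can be reindexed by its own members.
\<close>

lemma good_family_reindex:
  fixes I :: "'i set" and C :: "'i \<Rightarrow> 'a::semigroup_mult set"
  assumes "good_family F A I C"
  shows "\<exists>(J :: 'a set set) (D :: 'a set \<Rightarrow> 'a set). good_family F A J D"
proof -
  have "good_family F A (C ` I) (\<lambda>X. X)"
    using assms by (simp add: good_family_def downward_directed_def)
  then show ?thesis by blast
qed

definition good_sequence :: "'a::semigroup_mult filter \<Rightarrow> 'a set \<Rightarrow> (nat \<Rightarrow> 'a set) \<Rightarrow> bool"
  where "good_sequence F A C \<longleftrightarrow>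
    antimono_on {1..} C \<and>
    (\<forall>n\<ge>1. C n \<subseteq> A) \<and>
    (\<forall>n\<ge>1. \<forall>x\<in>C n. \<exists>m\<ge>1. C m \<subseteq> left_quot x (C n)) \<and>
    (\<forall>n\<ge>1. piecewise_syndetic F (C n))"

end

theory Submission
  imports Defs
begin

text \<open>
  Closed subsets of \<open>\<beta>S\<close> correspond to filters, so compactness is replaced throughout by the
  existence of ultrafilters below a proper filter. A set is piecewise \<open>\<F>\<close>-syndetic iff it belongs
  to some member of \<open>K(T)\<close>. Given an idempotent \<open>p\<close> in the closure of \<open>K(T)\<close> with \<open>A \<in> p\<close>, the
  sequences whose finite products stay in \<open>{x \<in> A. x\<inverse>A \<in> p}\<close> form an \<open>FS\<close>-tree all of whose
  \<open>B\<^sub>f\<close> lie in \<open>p\<close>. Conversely, the members of the closure of \<open>K(T)\<close> containing every \<open>C\<^sub>F\<close> of a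
  family as in (d) form a nonempty closed semigroup, because closures of right ideals are right
  ideals; it contains an idempotent. For countable \<open>S\<close> the tree is countable, and intersecting the
  \<open>B\<^sub>f\<close> along an enumeration of it gives a sequence as in (e).
\<close>


section \<open>Ultrafilters\<close>

lemma ultrafilter_eventually_not_iff:
  assumes "ultrafilter p"
  shows "(\<forall>\<^sub>F x in p. \<not> P x) \<longleftrightarrow> \<not> (\<forall>\<^sub>F x in p. P x)"
proof
  assume not_P: "\<forall>\<^sub>F x in p. \<not> P x"
  show "\<not> (\<forall>\<^sub>F x in p. P x)"
  proof
    assume "\<forall>\<^sub>F x in p. P x"
    with not_P have "\<forall>\<^sub>F x in p. False"
      by eventually_elim simp
    then show False
      using assms by (simp add: ultrafilter_def trivial_limit_def)
  qed
next
  assume "\<not> (\<forall>\<^sub>F x in p. P x)"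
  then show "\<forall>\<^sub>F x in p. \<not> P x"
    using assms by (auto simp: ultrafilter_def dest: spec[of _ "Collect P"])
qed

lemma ultrafilter_Compl_iff: "ultrafilter p \<Longrightarrow> - A \<in>\<^sub>F p \<longleftrightarrow> \<not> A \<in>\<^sub>F p"
  by (simp add: ultrafilter_eventually_not_iff)

lemma ultrafilter_eqI:
  assumes "ultrafilter q" "p \<le> q" "p \<noteq> bot"
  shows "p = q"
proof (rule antisym)
  show "q \<le> p"
    unfolding filter_le_iff_mem
  proof (intro allI impI)
    fix A assume A: "A \<in>\<^sub>F p"
    show "A \<in>\<^sub>F q"
    proof (rule ccontr)
      assume "\<not> A \<in>\<^sub>F q"
      then have "- A \<in>\<^sub>F q"
        using assms(1) by (simp add: ultrafilter_eventually_not_iff)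
      then have "- A \<in>\<^sub>F p"
        using assms(2) by (simp add: le_filter_def)
      with A have "\<forall>\<^sub>F x in p. False"
        by eventually_elim simp
      then show False
        using assms(3) by (simp add: trivial_limit_def)
    qed
  qed
qed fact

lemma ultrafilter_le_iff_eq: "ultrafilter p \<Longrightarrow> ultrafilter q \<Longrightarrow> p \<le> q \<longleftrightarrow> p = q"
  by (metis order_refl ultrafilter_def ultrafilter_eqI)

text \<open>Zorn's lemma for refinement. The infimum of a chain of proper filters is proper because
  the chain is a base for it, which does the work of compactness. Depending on \<open>P\<close> the
  result is an ultrafilter, a minimal closed subsemigroup or a minimal closed left ideal.\<close>

lemma finest_filter_exists:
  fixes G :: "'a filter"
  assumes "G \<noteq> bot" "P G"
    and Inf: "\<And>C. C \<noteq> {} \<Longrightarrow> (\<And>H. H \<in> C \<Longrightarrow> P H) \<Longrightarrow> P (Inf C)"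
  obtains M where "M \<le> G" "M \<noteq> bot" "P M"
    "\<forall>H. H \<le> M \<longrightarrow> H \<noteq> bot \<longrightarrow> P H \<longrightarrow> H = M"
proof -
  let ?A = "{H. H \<le> G \<and> H \<noteq> bot \<and> P H}"
  have "\<exists>m\<in>?A. \<forall>a\<in>?A. m \<ge> a \<longrightarrow> a = m"
  proof (rule predicate_Zorn)
    show "partial_order_on ?A (relation_of (\<lambda>x y. x \<ge> y) ?A)"
      by (auto simp: partial_order_on_def preorder_on_def relation_of_def refl_on_def
          trans_def antisym_def)
  next
    fix C assume C: "C \<in> Chains (relation_of (\<lambda>x y. x \<ge> y) ?A)"
    show "\<exists>u\<in>?A. \<forall>a\<in>C. a \<ge> u"
    proof (cases "C = {}")
      case True
      then show ?thesis using assms(1,2) by auto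
    next
      case False
      have sub: "C \<subseteq> ?A" and chain: "\<And>a b. a \<in> C \<Longrightarrow> b \<in> C \<Longrightarrow> a \<le> b \<or> b \<le> a"
        using C by (auto simp: Chains_def relation_of_def)
      \<comment> \<open>A chain is directed, so every member of its infimum is already a member of
        one of its filters; in particular the empty set is not.\<close>
      have "eventually Q (Inf C) \<longleftrightarrow> (\<exists>b\<in>C. eventually Q b)" for Q
      proof (rule eventually_Inf_base[OF False])
        show "\<exists>x\<in>C. x \<le> inf a b" if "a \<in> C" "b \<in> C" for a b
          using chain[OF that] that by auto
      qed
      then have "Inf C \<noteq> bot"
        using sub by (auto simp: trivial_limit_def)
      moreover have "Inf C \<le> G"
        using False sub by (auto intro: Inf_lower2)
      moreover have "P (Inf C)"
        by (rule Inf[OF False]) (use sub in auto)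
      ultimately show ?thesis
        by (auto intro: Inf_lower)
    qed
  qed
  then show ?thesis
    using that by (auto intro: order_trans)
qed

text \<open>A finest proper filter decides every \<open>A\<close>: cutting it down to
  \<open>A\<close> either gives the improper filter, so that \<open>- A\<close> is a member, or
  changes nothing.\<close>

lemma ultrafilter_below_exists:
  assumes "G \<noteq> bot"
  obtains p where "ultrafilter p" "p \<le> G"
proof -
  obtain M where M: "M \<le> G" "M \<noteq> bot" "\<forall>H. H \<le> M \<longrightarrow> H \<noteq> bot \<longrightarrow> H = M"
    by (rule finest_filter_exists[of G "\<lambda>_. True"]) (use assms in auto)
  have "A \<in>\<^sub>F M \<or> - A \<in>\<^sub>F M" for A
  proof (cases "inf M (principal A) = bot")
    case True
    then have "eventually (\<lambda>_. False) (inf M (principal A))"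
      by simp
    then show ?thesis
      by (auto simp: eventually_inf_principal elim: eventually_mono)
  next
    case False
    then have "inf M (principal A) = M"
      by (intro M(3)[rule_format]) auto
    moreover have "A \<in>\<^sub>F inf M (principal A)"
      by (simp add: eventually_inf_principal)
    ultimately show ?thesis by simp
  qed
  with M have "ultrafilter M"
    by (simp add: ultrafilter_def)
  then show ?thesis using that M(1) by blast
qed

text \<open>If \<open>A\<close> were missing from \<open>F\<close>, then \<open>F\<close> cut down
  to \<open>- A\<close> would be proper, and an ultrafilter below it would contradict the
  assumption.\<close>

lemma filter_memI_ultrafilter:
  assumes "\<And>p. ultrafilter p \<Longrightarrow> p \<le> F \<Longrightarrow> A \<in>\<^sub>F p"
  shows "A \<in>\<^sub>F F"
proof (rule ccontr)
  assume "\<not> A \<in>\<^sub>F F"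
  then have "inf F (principal (- A)) \<noteq> bot"
    by (auto simp: trivial_limit_def eventually_inf_principal)
  then obtain p where p: "ultrafilter p" "p \<le> inf F (principal (- A))"
    by (rule ultrafilter_below_exists)
  then have "- A \<in>\<^sub>F p"
    by (simp add: le_principal)
  with assms p show False
    by (simp add: ultrafilter_eventually_not_iff)
qed

text \<open>Compactness. The hypothesis says that every finite intersection of the
  \<open>C i\<close> meets every member of \<open>F\<close>, hence \<open>F\<close> and the
  \<open>C i\<close> together generate a proper filter; the case \<open>X = {}\<close> makes
  \<open>F\<close> itself proper.\<close>

lemma ultrafilter_inf_INF_principal_exists:
  assumes "\<And>X. finite X \<Longrightarrow> X \<subseteq> I \<Longrightarrow> \<not> - (\<Inter>i\<in>X. C i) \<in>\<^sub>F F"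
  obtains p where "ultrafilter p" "p \<le> F" "\<forall>i\<in>I. C i \<in>\<^sub>F p"
proof -
  have "inf F (INF i\<in>I. principal (C i)) \<noteq> bot"
  proof
    assume "inf F (INF i\<in>I. principal (C i)) = bot"
    then have "eventually (\<lambda>_. False) (inf F (INF i\<in>I. principal (C i)))"
      by simp
    then obtain Q R where Q: "eventually Q F" and R: "eventually R (INF i\<in>I. principal (C i))"
      and QR: "\<And>x. \<not> (Q x \<and> R x)"
      by (auto simp: eventually_inf)
    obtain X where X: "finite X" "X \<subseteq> I" "eventually R (principal (\<Inter>i\<in>X. C i))"
      using eventually_INF[THEN iffD1, OF R] by (auto simp: INF_principal_finite)
    from Q have "- (\<Inter>i\<in>X. C i) \<in>\<^sub>F F"
      by eventually_elim (use X(3) QR in \<open>auto simp: eventually_principal\<close>)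
    with assms X show False by blast
  qed
  then obtain p where p: "ultrafilter p" "p \<le> inf F (INF i\<in>I. principal (C i))"
    by (rule ultrafilter_below_exists)
  have "p \<le> principal (C i)" if "i \<in> I" for i
    using order_trans[OF p(2)] INF_lower[OF that, of "\<lambda>i. principal (C i)"] by (auto intro: le_infI2)
  with p that show ?thesis
    by (simp add: le_principal)
qed


section \<open>The semigroup of ultrafilters\<close>

lemma beta_mult_assoc: "(p \<odot> q) \<odot> r = p \<odot> (q \<odot> r)"
  by (simp add: filter_eq_iff eventually_beta_mult mult.assoc)

lemma beta_mult_mono: "p \<le> p' \<Longrightarrow> q \<le> q' \<Longrightarrow> p \<odot> q \<le> p' \<odot> q'"
  unfolding le_filter_def eventually_beta_mult
  by (metis (mono_tags, lifting) eventually_mono)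

lemma beta_mult_neq_bot: "p \<noteq> bot \<Longrightarrow> q \<noteq> bot \<Longrightarrow> p \<odot> q \<noteq> bot"
  by (simp add: trivial_limit_def eventually_beta_mult)

lemma ultrafilter_beta_mult:
  assumes "ultrafilter p" "ultrafilter q"
  shows "ultrafilter (p \<odot> q)"
proof -
  have "A \<in>\<^sub>F p \<odot> q \<or> - A \<in>\<^sub>F p \<odot> q" for A
  proof -
    have "- {x. left_quot x A \<in>\<^sub>F q} = {x. left_quot x (- A) \<in>\<^sub>F q}"
      using ultrafilter_Compl_iff[OF assms(2), of "left_quot _ A"]
      by (auto simp: left_quot_def)
    then show ?thesis
      using assms(1) unfolding mem_beta_mult_iff ultrafilter_def by metis
  qed
  then show ?thesis
    using assms by (simp add: ultrafilter_def beta_mult_neq_bot)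
qed

lemma filter_closureD: "p \<in> filter_closure F \<Longrightarrow> V \<in>\<^sub>F F \<Longrightarrow> V \<in>\<^sub>F p"
  by (auto simp: filter_closure_def le_filter_def)

lemma filter_closure_neq_bot: "p \<in> filter_closure F \<Longrightarrow> p \<noteq> bot"
  by (simp add: filter_closure_def ultrafilter_def)

text \<open>Since a filter is the intersection of the ultrafilters below it, passing to the closure
  loses nothing; inclusions of closed sets can be proved pointwise and used as refinements.\<close>

lemma filter_le_iff_closure: "G \<le> F \<longleftrightarrow> filter_closure G \<subseteq> filter_closure F"
proof
  assume sub: "filter_closure G \<subseteq> filter_closure F"
  show "G \<le> F"
    unfolding filter_le_iff_mem
  proof (intro allI impI, rule filter_memI_ultrafilter)
    fix A p assume A: "A \<in>\<^sub>F F" and "ultrafilter p" "p \<le> G"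
    with sub have "p \<in> filter_closure F"
      by (auto simp: filter_closure_def)
    then show "A \<in>\<^sub>F p"
      using A by (rule filter_closureD)
  qed
qed (auto simp: filter_closure_def)

lemma filter_closure_Inf_iff:
  "p \<in> filter_closure (Inf C) \<longleftrightarrow> ultrafilter p \<and> (\<forall>H\<in>C. p \<in> filter_closure H)"
  by (auto simp: filter_closure_def le_Inf_iff)

lemma filter_closure_nonempty: "F \<noteq> bot \<Longrightarrow> filter_closure F \<noteq> {}"
  by (metis (mono_tags) empty_iff filter_closure_def mem_Collect_eq ultrafilter_below_exists)

text \<open>Replaces the argument that right translations, being continuous, map compact sets to closed
  sets.\<close>

lemma filter_closure_beta_mult:
  assumes "ultrafilter q"
  shows "filter_closure (F \<odot> q) = (\<lambda>r. r \<odot> q) ` filter_closure F"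
proof
  show "(\<lambda>r. r \<odot> q) ` filter_closure F \<subseteq> filter_closure (F \<odot> q)"
    using assms by (auto simp: filter_closure_def ultrafilter_beta_mult beta_mult_mono)
  show "filter_closure (F \<odot> q) \<subseteq> (\<lambda>r. r \<odot> q) ` filter_closure F"
  proof
    fix u assume u: "u \<in> filter_closure (F \<odot> q)"
    \<comment> \<open>An \<open>r\<close> with \<open>r \<odot> q = u\<close> must contain
      \<open>{x. left_quot x A \<in>\<^sub>F q}\<close> for every \<open>A\<close> in
      \<open>u\<close>. If finitely many of these sets had an intersection missing a member of
      \<open>F\<close>, the complement of \<open>\<Inter>X\<close> would be in
      \<open>F \<odot> q\<close>, hence in \<open>u\<close>.\<close>
    have *: "\<not> - (\<Inter>A\<in>X. {x. left_quot x A \<in>\<^sub>F q}) \<in>\<^sub>F F"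
      if X: "finite X" "X \<subseteq> {A. A \<in>\<^sub>F u}" for X
    proof
      assume a: "- (\<Inter>A\<in>X. {x. left_quot x A \<in>\<^sub>F q}) \<in>\<^sub>F F"
      have eq: "- (\<Inter>A\<in>X. {x. left_quot x A \<in>\<^sub>F q}) = {x. left_quot x (- \<Inter>X) \<in>\<^sub>F q}"
      proof -
        have "(\<forall>A\<in>X. left_quot x A \<in>\<^sub>F q) \<longleftrightarrow> left_quot x (\<Inter>X) \<in>\<^sub>F q" for x
          using eventually_ball_finite_distrib[OF X(1), of "\<lambda>y A. x * y \<in> A" q]
          by (simp add: left_quot_def)
        moreover have "left_quot x (- \<Inter>X) = - left_quot x (\<Inter>X)" for x
          by (auto simp: left_quot_def)
        ultimately have "left_quot x (- \<Inter>X) \<in>\<^sub>F q \<longleftrightarrow> \<not> (\<forall>A\<in>X. left_quot x A \<in>\<^sub>F q)" for x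
          by (simp only: ultrafilter_Compl_iff[OF assms])
        then show ?thesis
          by (simp only: set_eq_iff Compl_iff INT_iff mem_Collect_eq simp_thms)
      qed
      have "- \<Inter>X \<in>\<^sub>F F \<odot> q"
        using a unfolding eq mem_beta_mult_iff .
      then have "- \<Inter>X \<in>\<^sub>F u"
        using u filter_closureD by blast
      moreover have "\<Inter>X \<in>\<^sub>F u"
        using X by (auto simp: eventually_ball_finite_distrib)
      ultimately show False
        using u ultrafilter_Compl_iff unfolding filter_closure_def by blast
    qed
    obtain r where r: "ultrafilter r" "r \<le> F"
      "\<forall>A\<in>{A. A \<in>\<^sub>F u}. {x. left_quot x A \<in>\<^sub>F q} \<in>\<^sub>F r"
      by (rule ultrafilter_inf_INF_principal_exists[OF *])
    have "r \<odot> q \<le> u"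
      unfolding filter_le_iff_mem mem_beta_mult_iff using r(3) by blast
    moreover have "ultrafilter u"
      using u by (simp add: filter_closure_def)
    ultimately have "r \<odot> q = u"
      using r(1) assms by (simp add: ultrafilter_le_iff_eq ultrafilter_beta_mult)
    then show "u \<in> (\<lambda>r. r \<odot> q) ` filter_closure F"
      using r by (auto simp: filter_closure_def)
  qed
qed

section \<open>Idempotents and the smallest ideal\<close>

text \<open>Sets \<open>filter_closure F\<close> are closed, and nonempty for
  \<open>F \<noteq> bot\<close>, so for them this is all that remains to ask of a closed
  subsemigroup.\<close>

definition mult_closed :: "'a::semigroup_mult filter set \<Rightarrow> bool"
  where "mult_closed T \<longleftrightarrow> (\<forall>p\<in>T. \<forall>q\<in>T. p \<odot> q \<in> T)"

text \<open>Ellis--Numakura: for \<open>p\<close> in a minimal closed subsemigroup \<open>M\<close>, both \<open>M \<odot> p\<close> and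
  \<open>{r \<in> M. r \<odot> p = p}\<close> are closed subsemigroups contained in \<open>M\<close>, hence equal to \<open>M\<close>.\<close>

lemma idempotent_exists:
  assumes "F \<noteq> bot" "mult_closed (filter_closure F)"
  obtains p where "p \<in> filter_closure F" "p \<odot> p = p"
proof -
  have Inf: "mult_closed (filter_closure (Inf C))"
    if "\<And>H. H \<in> C \<Longrightarrow> mult_closed (filter_closure H)" for C :: "'a filter set"
    using that by (simp add: mult_closed_def filter_closure_Inf_iff ultrafilter_beta_mult)
  obtain M where M: "M \<le> F" "M \<noteq> bot" "mult_closed (filter_closure M)"
    "\<forall>H. H \<le> M \<longrightarrow> H \<noteq> bot \<longrightarrow> mult_closed (filter_closure H) \<longrightarrow> H = M"
    by (rule finest_filter_exists[of F "\<lambda>H. mult_closed (filter_closure H)"])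
      (use assms Inf in auto)
  obtain p where p: "p \<in> filter_closure M"
    using filter_closure_nonempty[OF M(2)] by blast
  then have uf: "ultrafilter p"
    by (simp add: filter_closure_def)
  have sub: "filter_closure (M \<odot> p) \<subseteq> filter_closure M"
    using M(3) p by (auto simp: filter_closure_beta_mult[OF uf] mult_closed_def)
  have "M \<odot> p = M"
  proof (rule M(4)[rule_format])
    show "M \<odot> p \<le> M"
      using sub by (simp add: filter_le_iff_closure)
    show "M \<odot> p \<noteq> bot"
      using M(2) p by (simp add: beta_mult_neq_bot filter_closure_neq_bot)
    show "mult_closed (filter_closure (M \<odot> p))"
      unfolding mult_closed_def
    proof (intro ballI)
      fix u v assume uv: "u \<in> filter_closure (M \<odot> p)" "v \<in> filter_closure (M \<odot> p)"
      \<comment> \<open>Writing \<open>v\<close> as \<open>r \<odot> p\<close> gives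
        \<open>u \<odot> v = (u \<odot> r) \<odot> p\<close>, whose left factor is in
        \<open>filter_closure M\<close>.\<close>
      then obtain r where "v = r \<odot> p" "r \<in> filter_closure M"
        by (auto simp: filter_closure_beta_mult[OF uf])
      then show "u \<odot> v \<in> filter_closure (M \<odot> p)"
        using uv sub M(3)
        by (auto simp: filter_closure_beta_mult[OF uf] mult_closed_def beta_mult_assoc[symmetric])
    qed
  qed
  then have "p \<in> (\<lambda>r. r \<odot> p) ` filter_closure M"
    using p filter_closure_beta_mult[OF uf] by metis
  then obtain r where r: "r \<in> filter_closure M" "r \<odot> p = p"
    by force
  \<comment> \<open>\<open>N\<close> encodes
    \<open>{s \<in> filter_closure M. s \<odot> p = p}\<close>: the added sets say
    \<open>s \<odot> p \<le> p\<close>, which is equality between ultrafilters.\<close>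
  define N where "N = inf M (INF A\<in>{A. A \<in>\<^sub>F p}. principal {x. left_quot x A \<in>\<^sub>F p})"
  have N: "s \<in> filter_closure N \<longleftrightarrow> s \<in> filter_closure M \<and> s \<odot> p = p" for s
  proof -
    have "s \<odot> p \<le> p \<longleftrightarrow> s \<odot> p = p" if "ultrafilter s"
      by (intro ultrafilter_le_iff_eq ultrafilter_beta_mult uf that)
    moreover have "s \<odot> p \<le> p \<longleftrightarrow> (\<forall>A. A \<in>\<^sub>F p \<longrightarrow> {x. left_quot x A \<in>\<^sub>F p} \<in>\<^sub>F s)"
      unfolding filter_le_iff_mem mem_beta_mult_iff ..
    moreover have "s \<le> N \<longleftrightarrow> s \<le> M \<and> (\<forall>A. A \<in>\<^sub>F p \<longrightarrow> {x. left_quot x A \<in>\<^sub>F p} \<in>\<^sub>F s)"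
      by (simp add: N_def le_INF_iff le_principal)
    ultimately show ?thesis
      unfolding filter_closure_def by blast
  qed
  have "N = M"
  proof (rule M(4)[rule_format])
    show "N \<le> M"
      by (simp add: N_def)
    show "N \<noteq> bot"
    proof
      assume "N = bot"
      moreover have "r \<in> filter_closure N"
        using r N by blast
      ultimately show False
        by (auto simp: filter_closure_def ultrafilter_def bot_unique)
    qed
    show "mult_closed (filter_closure N)"
      using M(3) by (auto simp: N mult_closed_def beta_mult_assoc)
  qed
  then have "p \<odot> p = p"
    using N p by blast
  moreover have "p \<in> filter_closure F"
    using p M(1) filter_le_iff_closure by blast
  ultimately show ?thesis using that by blast
qed

text \<open>The set on the right consists of the \<open>p\<close> in \<open>T\<close> that generate a minimal left ideal.\<close>

lemma
  assumes "F \<noteq> bot" and T: "mult_closed (filter_closure F)"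
  shows smallest_ideal_eq: "smallest_ideal (filter_closure F) =
    {p \<in> filter_closure F. \<forall>r\<in>filter_closure F. \<exists>s\<in>filter_closure F. p = s \<odot> r \<odot> p}"
    (is "?K = ?R")
  and smallest_ideal_meets: "p \<in> filter_closure F \<Longrightarrow>
      \<exists>q \<in> smallest_ideal (filter_closure F). q \<in> filter_closure (F \<odot> p)"
  and two_sided_ideal_smallest_ideal: "two_sided_ideal (filter_closure F) (smallest_ideal (filter_closure F))"
proof -
  let ?T = "filter_closure F"
  have mult: "p \<odot> q \<in> ?T" if "p \<in> ?T" "q \<in> ?T" for p q
    using T that by (simp add: mult_closed_def)
  have ex: "\<exists>q \<in> ?R. q \<in> filter_closure (F \<odot> p)" if p: "p \<in> ?T" for p
  proof -
    \<comment> \<open>\<open>?P H\<close> says that \<open>filter_closure H\<close> is a closed,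
      possibly empty, left ideal of \<open>?T\<close>.\<close>
    let ?P = "\<lambda>H. H \<le> F \<and> (\<forall>r\<in>?T. \<forall>q\<in>filter_closure H. r \<odot> q \<in> filter_closure H)"
    have le: "F \<odot> q \<le> H" if "q \<in> ?T" "\<And>r. r \<in> ?T \<Longrightarrow> r \<odot> q \<in> filter_closure H" for H q
    proof -
      have "ultrafilter q"
        using that(1) by (simp add: filter_closure_def)
      then show ?thesis
        using that(2) unfolding filter_le_iff_closure by (auto simp: filter_closure_beta_mult)
    qed
    have P: "?P (F \<odot> q)" if q: "q \<in> ?T" for q
    proof -
      have "ultrafilter q"
        using q by (simp add: filter_closure_def)
      then show ?thesis
        using le[OF q mult[OF _ q]] mult
        by (auto simp: filter_closure_beta_mult beta_mult_assoc[symmetric])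
    qed
    have Inf: "?P (Inf C)" if "C \<noteq> {}" "\<And>H. H \<in> C \<Longrightarrow> ?P H" for C
    proof -
      have "Inf C \<le> F"
        using that by (auto intro: Inf_lower2)
      moreover have "r \<odot> q \<in> filter_closure (Inf C)" if "r \<in> ?T" "q \<in> filter_closure (Inf C)" for r q
        using \<open>\<And>H. H \<in> C \<Longrightarrow> ?P H\<close> that
        by (simp add: filter_closure_Inf_iff ultrafilter_beta_mult filter_closure_def[of F])
      ultimately show ?thesis by blast
    qed
    have nb: "F \<odot> q \<noteq> bot" if "q \<in> ?T" for q
      using assms(1) that by (simp add: beta_mult_neq_bot filter_closure_neq_bot)
    obtain M where M: "M \<le> F \<odot> p" "M \<noteq> bot" "?P M"
      "\<forall>H. H \<le> M \<longrightarrow> H \<noteq> bot \<longrightarrow> ?P H \<longrightarrow> H = M"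
      by (rule finest_filter_exists[of "F \<odot> p" ?P, OF nb[OF p] P[OF p] Inf])
    obtain q where q: "q \<in> filter_closure M"
      using filter_closure_nonempty[OF M(2)] by blast
    have qT: "q \<in> ?T"
      using q M(3) filter_le_iff_closure by blast
    have "\<exists>s\<in>?T. q = s \<odot> r \<odot> q" if r: "r \<in> ?T" for r
    proof -
      have rq: "r \<odot> q \<in> filter_closure M"
        using M(3) q r by blast
      have rqT: "r \<odot> q \<in> ?T"
        using mult r qT by blast
      \<comment> \<open>The left ideal generated by \<open>r \<odot> q\<close> lies in the minimal
        one given by \<open>M\<close>, so they coincide and \<open>q\<close> is a left multiple of
        \<open>r \<odot> q\<close>.\<close>
      have "F \<odot> (r \<odot> q) = M"
        using M(3) rq rqT by (intro M(4)[rule_format] le nb P) auto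
      then have "q \<in> (\<lambda>s. s \<odot> (r \<odot> q)) ` ?T"
        using q rqT by (metis filter_closure_beta_mult filter_closure_def mem_Collect_eq)
      then show ?thesis
        by (auto simp: beta_mult_assoc)
    qed
    with q qT M(1)[unfolded filter_le_iff_closure] show ?thesis by blast
  qed
  have ideal: "two_sided_ideal ?T ?R"
    unfolding two_sided_ideal_def
  proof (intro conjI ballI)
    show "?R \<noteq> {}"
      using ex filter_closure_nonempty[OF assms(1)] by blast
  next
    fix t p assume t: "t \<in> ?T" and p: "p \<in> ?R"
    show "t \<odot> p \<in> ?R"
    proof (intro CollectI conjI ballI)
      fix r assume r: "r \<in> ?T"
      \<comment> \<open>The defining property of \<open>p\<close> is used for
        \<open>r \<odot> t\<close>; multiplying by \<open>t\<close> on the left then gives the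
        multiplier \<open>t \<odot> s\<close>.\<close>
      then obtain s where "s \<in> ?T" "p = s \<odot> (r \<odot> t) \<odot> p"
        using p mult[OF r t] by blast
      then have "t \<odot> p = (t \<odot> s) \<odot> r \<odot> (t \<odot> p)" "t \<odot> s \<in> ?T"
        using mult t by (simp_all add: beta_mult_assoc)
      then show "\<exists>s\<in>?T. t \<odot> p = s \<odot> r \<odot> (t \<odot> p)" by blast
    qed (use p t mult in auto)
    show "p \<odot> t \<in> ?R"
    proof (intro CollectI conjI ballI)
      fix r assume r: "r \<in> ?T"
      then obtain s where "s \<in> ?T" "p = s \<odot> r \<odot> p"
        using p by blast
      then show "\<exists>s\<in>?T. p \<odot> t = s \<odot> r \<odot> (p \<odot> t)"
        by (metis beta_mult_assoc)
    qed (use p t mult in auto)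
  qed auto
  have "?R \<subseteq> J" if J: "two_sided_ideal ?T J" for J
  proof
    fix p assume p: "p \<in> ?R"
    obtain q where q: "q \<in> J" "q \<in> ?T"
      using J by (auto simp: two_sided_ideal_def)
    \<comment> \<open>With the middle factor \<open>q\<close> in \<open>J\<close>, the whole product
      is in \<open>J\<close>.\<close>
    then obtain s where "s \<in> ?T" "p = s \<odot> q \<odot> p"
      using p by blast
    then show "p \<in> J"
      using J q p unfolding two_sided_ideal_def by (metis (no_types, lifting) mem_Collect_eq)
  qed
  with ideal show K: "?K = ?R"
    unfolding smallest_ideal_def by (intro Least_equality) auto
  show "two_sided_ideal ?T ?K"
    using ideal K by simp
  show "\<exists>q \<in> ?K. q \<in> filter_closure (F \<odot> p)" if "p \<in> ?T"
    using ex[OF that] K by simp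
qed

section \<open>Closures in the space of ultrafilters\<close>

text \<open>The right side says that each basic neighbourhood of \<open>p\<close> meets
  \<open>K\<close>. The members of \<open>Sup K\<close> are the sets common to all of
  \<open>K\<close>, so a set in \<open>p\<close> lying in no \<open>q \<in> K\<close> has its
  complement in \<open>Sup K\<close>.\<close>

lemma ultrafilter_le_Sup_iff:
  assumes K: "K \<subseteq> Collect ultrafilter" and p: "ultrafilter p"
  shows "p \<le> Sup K \<longleftrightarrow> (\<forall>A. A \<in>\<^sub>F p \<longrightarrow> (\<exists>q\<in>K. A \<in>\<^sub>F q))"
proof
  assume le: "p \<le> Sup K"
  show "\<forall>A. A \<in>\<^sub>F p \<longrightarrow> (\<exists>q\<in>K. A \<in>\<^sub>F q)"
  proof (intro allI impI, rule ccontr)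
    fix A assume A: "A \<in>\<^sub>F p" "\<not> (\<exists>q\<in>K. A \<in>\<^sub>F q)"
    then have "- A \<in>\<^sub>F Sup K"
      using K ultrafilter_Compl_iff unfolding eventually_Sup by blast
    then have "- A \<in>\<^sub>F p"
      using le unfolding filter_le_iff_mem by blast
    with A p show False
      using ultrafilter_Compl_iff by blast
  qed
next
  assume *: "\<forall>A. A \<in>\<^sub>F p \<longrightarrow> (\<exists>q\<in>K. A \<in>\<^sub>F q)"
  show "p \<le> Sup K"
    unfolding filter_le_iff_mem eventually_Sup
  proof (intro allI impI, rule ccontr)
    fix A assume A: "\<forall>q\<in>K. A \<in>\<^sub>F q" "\<not> A \<in>\<^sub>F p"
    then obtain q where "q \<in> K" "- A \<in>\<^sub>F q"
      using * p by (metis ultrafilter_Compl_iff)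
    with A K show False
      using ultrafilter_Compl_iff by blast
  qed
qed

text \<open>Turns topological closure into refinement of one filter, so that later arguments can
  work with \<open>Sup K\<close> alone.\<close>

lemma beta_closure_of:
  assumes "K \<subseteq> Collect ultrafilter"
  shows "beta_topology closure_of K = filter_closure (Sup K)"
proof (rule set_eqI)
  fix p :: "'a filter"
  let ?B = "\<lambda>A. {q. ultrafilter q \<and> A \<in>\<^sub>F q} :: 'a filter set"
  \<comment> \<open>The generating sets are stable under intersection, since \<open>?B A\<close> and
    \<open>?B B\<close> meet in \<open>?B (A \<inter> B)\<close>; so they form a base.\<close>
  have base: "\<exists>A. p \<in> ?B A \<and> ?B A \<subseteq> U" if "generate_topology_on {?B A | A. True} U" "p \<in> U" for U
    using that
  proof induction
    case (Int a b)
    then obtain A B where "p \<in> ?B A" "?B A \<subseteq> a" "p \<in> ?B B" "?B B \<subseteq> b"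
      by auto
    then have "p \<in> ?B (A \<inter> B) \<and> ?B (A \<inter> B) \<subseteq> a \<inter> b"
      by (auto simp: eventually_conj_iff)
    then show ?case by blast
  next
    case (UN K)
    then show ?case by (meson UnionE Union_upper order_trans)
  qed auto
  have op: "openin beta_topology (?B A)" for A
    unfolding beta_topology_def by (rule topology_generated_by_Basis) blast
  have "p \<in> beta_topology closure_of K \<longleftrightarrow>
      ultrafilter p \<and> (\<forall>U. p \<in> U \<and> openin beta_topology U \<longrightarrow> (\<exists>q\<in>K. q \<in> U))"
    by (auto simp: in_closure_of topspace_beta_topology)
  also have "\<dots> \<longleftrightarrow> ultrafilter p \<and> (\<forall>A. A \<in>\<^sub>F p \<longrightarrow> (\<exists>q\<in>K. A \<in>\<^sub>F q))"
  proof (intro conj_cong refl iffI allI impI)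
    fix A assume "\<forall>U. p \<in> U \<and> openin beta_topology U \<longrightarrow> (\<exists>q\<in>K. q \<in> U)" "A \<in>\<^sub>F p" "ultrafilter p"
    then show "\<exists>q\<in>K. A \<in>\<^sub>F q"
      using op[of A] by (auto dest!: spec[of _ "?B A"])
  next
    fix U assume *: "\<forall>A. A \<in>\<^sub>F p \<longrightarrow> (\<exists>q\<in>K. A \<in>\<^sub>F q)" and U: "p \<in> U \<and> openin beta_topology U"
    then obtain A where "p \<in> ?B A" "?B A \<subseteq> U"
      using base[of U] unfolding beta_topology_def openin_topology_generated_by_iff by blast
    with * assms show "\<exists>q\<in>K. q \<in> U" by blast
  qed
  also have "\<dots> \<longleftrightarrow> p \<in> filter_closure (Sup K)"
    using ultrafilter_le_Sup_iff[OF assms, of p] by (auto simp: filter_closure_def)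
  finally show "p \<in> beta_topology closure_of K \<longleftrightarrow> p \<in> filter_closure (Sup K)" .
qed

lemma smallest_ideal_subset_ultrafilters:
  assumes "F \<noteq> bot" "mult_closed (filter_closure F)"
  shows "smallest_ideal (filter_closure F) \<subseteq> Collect ultrafilter"
  using two_sided_ideal_smallest_ideal[OF assms]
  by (auto simp: two_sided_ideal_def filter_closure_def)


section \<open>Piecewise syndetic sets\<close>

lemma ultrafilter_UN_mem:
  assumes "ultrafilter p" "finite I" "(\<Union>i\<in>I. C i) \<in>\<^sub>F p"
  shows "\<exists>i\<in>I. C i \<in>\<^sub>F p"
proof (rule ccontr)
  assume "\<not> ?thesis"
  then have "\<forall>i\<in>I. \<forall>\<^sub>F x in p. x \<notin> C i"
    using assms(1) by (simp add: ultrafilter_eventually_not_iff)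
  then have "\<forall>\<^sub>F x in p. \<forall>i\<in>I. x \<notin> C i"
    using assms(2) by (simp add: eventually_ball_finite_distrib)
  then have "- (\<Union>i\<in>I. C i) \<in>\<^sub>F p"
    by simp
  with assms(1,3) show False
    using ultrafilter_Compl_iff by blast
qed

lemma finite_Inter_mem:
  assumes "finite \<B>" "\<forall>B\<in>\<B>. B \<in>\<^sub>F p"
  shows "\<Inter>\<B> \<in>\<^sub>F p"
  using assms by (simp add: eventually_ball_finite_distrib)

text \<open>The finite intersection property yields \<open>q\<close> in the closure of
  \<open>F\<close> such that \<open>left_quot_set (G V) A\<close> is in every ultrafilter of
  \<open>filter_closure (F \<odot> q)\<close>. This left ideal meets the smallest ideal, and a
  further left multiplication turns the translates of \<open>A\<close> into \<open>A\<close>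
  itself.\<close>

lemma piecewise_syndetic_imp_smallest_ideal:
  assumes "F \<noteq> bot" and T: "mult_closed (filter_closure F)" and "piecewise_syndetic F A"
  shows "\<exists>p \<in> smallest_ideal (filter_closure F). A \<in>\<^sub>F p"
proof -
  let ?K = "smallest_ideal (filter_closure F)"
  obtain G W where
    GW: "\<forall>V. V \<in>\<^sub>F F \<longrightarrow> finite (G V) \<and> G V \<subseteq> V \<and> W V \<in>\<^sub>F F" and
    "fip {left_quot x (left_quot_set (G V) A) \<inter> V | V x. V \<in>\<^sub>F F \<and> x \<in> W V}" (is "fip ?\<A>")
    using assms(3) unfolding piecewise_syndetic_def by (elim exE conjE)
  then have ne: "\<Inter>X \<noteq> {}" if "finite X" "X \<subseteq> ?\<A>" for X
    using that unfolding fip_def by (cases "X = {}") simp_all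
  \<comment> \<open>Only \<open>UNIV\<close> belongs to \<open>top\<close>, so this merely says that
    finite intersections are nonempty.\<close>
  have *: "\<not> - (\<Inter>B\<in>X. B) \<in>\<^sub>F top" if "finite X" "X \<subseteq> ?\<A>" for X
    using ne[OF that] by (simp only: eventually_top Compl_iff image_ident) blast
  obtain q where q: "ultrafilter q" "\<forall>B\<in>?\<A>. B \<in>\<^sub>F q"
    by (rule ultrafilter_inf_INF_principal_exists[OF *])
  have q_mem: "left_quot x (left_quot_set (G V) A) \<inter> V \<in>\<^sub>F q" if "V \<in>\<^sub>F F" "x \<in> W V" for V x
    using q(2) that by blast
  \<comment> \<open>The factor \<open>V\<close> in the family forces \<open>V\<close> into
    \<open>q\<close>; an index \<open>x\<close> exists because \<open>W V\<close> is a member of the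
    proper filter \<open>F\<close>.\<close>
  have "q \<le> F"
    unfolding filter_le_iff_mem
  proof (intro allI impI)
    fix V assume V: "V \<in>\<^sub>F F"
    then have "W V \<in>\<^sub>F F"
      using GW by blast
    then obtain x where "x \<in> W V"
      using assms(1) eventually_happens by blast
    from q_mem[OF V this] show "V \<in>\<^sub>F q"
      by (rule eventually_mono) blast
  qed
  with q(1) have "q \<in> filter_closure F"
    by (simp add: filter_closure_def)
  then obtain p where p: "p \<in> ?K" "p \<in> filter_closure (F \<odot> q)"
    using smallest_ideal_meets[OF assms(1) T] by blast
  \<comment> \<open>Finiteness of \<open>G V\<close> lets the ultrafilter \<open>p\<close> choose
    one translate, and \<open>G V \<subseteq> V\<close> puts its index in \<open>V\<close>.\<close>
  have ex: "\<exists>x\<in>V. left_quot x A \<in>\<^sub>F p" if V: "V \<in>\<^sub>F F" for V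
  proof -
    have "W V \<in>\<^sub>F F"
      using GW V by blast
    then have "left_quot_set (G V) A \<in>\<^sub>F F \<odot> q"
      unfolding mem_beta_mult_iff
      by (rule eventually_mono) (use q_mem[OF V] in \<open>simp add: eventually_conj_iff\<close>)
    then have "(\<Union>x\<in>G V. left_quot x A) \<in>\<^sub>F p"
      using filter_closureD[OF p(2)] by (simp only: left_quot_set_def)
    then show ?thesis
      using ultrafilter_UN_mem[of p "G V" "\<lambda>x. left_quot x A"] GW V p(2)
      unfolding filter_closure_def by blast
  qed
  \<comment> \<open>The set of these \<open>x\<close> meets every member of \<open>F\<close>, so it
    belongs to some ultrafilter \<open>r\<close> below \<open>F\<close>.\<close>
  have "\<not> - {x. left_quot x A \<in>\<^sub>F p} \<in>\<^sub>F F"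
    using ex by blast
  then obtain r where r: "ultrafilter r" "r \<le> F" "\<not> - {x. left_quot x A \<in>\<^sub>F p} \<in>\<^sub>F r"
    using filter_memI_ultrafilter by blast
  then have "A \<in>\<^sub>F r \<odot> p"
    unfolding mem_beta_mult_iff using ultrafilter_Compl_iff by blast
  moreover have "r \<odot> p \<in> ?K"
    using two_sided_ideal_smallest_ideal[OF assms(1) T] r(1,2) p(1)
    unfolding two_sided_ideal_def filter_closure_def by blast
  ultimately show ?thesis by blast
qed

text \<open>The sets \<open>W V\<close> are defined through \<open>p\<close>, which puts the whole
  family in \<open>p\<close>. A finite \<open>G V\<close> with \<open>W V\<close> in
  \<open>F\<close> exists by minimality: \<open>p\<close> is a left multiple of
  \<open>r \<odot> p\<close> for every \<open>r\<close> in the closure of \<open>F\<close>.\<close>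

lemma smallest_ideal_imp_piecewise_syndetic:
  assumes "F \<noteq> bot" and T: "mult_closed (filter_closure F)"
    and K: "p \<in> smallest_ideal (filter_closure F)" and A: "A \<in>\<^sub>F p"
  shows "piecewise_syndetic F A"
proof -
  have p: "p \<in> filter_closure F"
    "\<And>r. r \<in> filter_closure F \<Longrightarrow> \<exists>s\<in>filter_closure F. p = s \<odot> r \<odot> p"
    using K unfolding smallest_ideal_eq[OF assms(1) T] by auto
  let ?W = "\<lambda>G. {y. left_quot y (left_quot_set G A) \<in>\<^sub>F p}"
  let ?D = "\<lambda>x. {y. left_quot y (left_quot x A) \<in>\<^sub>F p}"
  have ex: "\<exists>G. finite G \<and> G \<subseteq> V \<and> ?W G \<in>\<^sub>F F" if V: "V \<in>\<^sub>F F" for V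
  proof (rule ccontr)
    assume no: "\<not> ?thesis"
    \<comment> \<open>If no finite \<open>G\<close> worked, finitely many of the sets
      \<open>?D x\<close> with \<open>x \<in> V\<close> would never cover a member of
      \<open>F\<close>, so some \<open>r\<close> avoids them all.\<close>
    have *: "\<not> - (\<Inter>x\<in>X. - ?D x) \<in>\<^sub>F F" if "finite X" "X \<subseteq> V" for X
    proof
      assume "- (\<Inter>x\<in>X. - ?D x) \<in>\<^sub>F F"
      moreover have "- (\<Inter>x\<in>X. - ?D x) \<subseteq> ?W X"
        by (auto simp: left_quot_def left_quot_set_def elim: eventually_mono)
      ultimately have "?W X \<in>\<^sub>F F"
        by (metis (no_types, lifting) eventually_mono subsetD)
      with no that show False by blast
    qed
    obtain r where r: "ultrafilter r" "r \<le> F" "\<forall>x\<in>V. - ?D x \<in>\<^sub>F r"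
      by (rule ultrafilter_inf_INF_principal_exists[OF *])
    then have "r \<in> filter_closure F"
      by (simp add: filter_closure_def)
    \<comment> \<open>Minimality leads from \<open>r \<odot> p\<close> back to \<open>p\<close>. As
      \<open>A\<close> is in \<open>p\<close> and \<open>V\<close> in \<open>s\<close>, some
      \<open>x \<in> V\<close> has \<open>left_quot x A\<close> in \<open>r \<odot> p\<close>, that
      is, \<open>?D x\<close> in \<open>r\<close>.\<close>
    then obtain s where s: "s \<in> filter_closure F" "p = s \<odot> (r \<odot> p)"
      using p(2) beta_mult_assoc by metis
    then have "{x. left_quot x A \<in>\<^sub>F r \<odot> p} \<in>\<^sub>F s"
      using A by (metis mem_beta_mult_iff)
    moreover have "V \<in>\<^sub>F s"
      using s(1) V by (rule filter_closureD)
    ultimately have "\<forall>\<^sub>F x in s. x \<in> V \<and> left_quot x A \<in>\<^sub>F r \<odot> p"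
      by eventually_elim simp
    then obtain x where x: "x \<in> V" "left_quot x A \<in>\<^sub>F r \<odot> p"
      using s(1) filter_closure_neq_bot eventually_happens by blast
    then have "?D x \<in>\<^sub>F r"
      by (simp only: mem_beta_mult_iff)
    with r x(1) show False
      using ultrafilter_Compl_iff by blast
  qed
  have "\<forall>V. \<exists>G. V \<in>\<^sub>F F \<longrightarrow> finite G \<and> G \<subseteq> V \<and> ?W G \<in>\<^sub>F F"
    using ex by blast
  then obtain G where G: "\<forall>V. V \<in>\<^sub>F F \<longrightarrow> finite (G V) \<and> G V \<subseteq> V \<and> ?W (G V) \<in>\<^sub>F F"
    by (rule choice[THEN exE])
  have "fip {left_quot x (left_quot_set (G V) A) \<inter> V | V x. V \<in>\<^sub>F F \<and> x \<in> ?W (G V)}"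
    (is "fip ?\<A>")
    unfolding fip_def
  proof (intro allI impI, elim conjE)
    fix \<B> assume \<B>: "\<B> \<subseteq> ?\<A>" "finite \<B>"
    have mem: "B \<in>\<^sub>F p" if "B \<in> ?\<A>" for B
      using that filter_closureD[OF p(1)] by (auto simp: eventually_conj_iff)
    then have "\<Inter>\<B> \<in>\<^sub>F p"
      using \<B> by (intro finite_Inter_mem ballI mem) (auto dest: subsetD)
    then show "\<Inter>\<B> \<noteq> {}"
      using filter_closure_neq_bot[OF p(1)] eventually_happens by blast
  qed
  with G show ?thesis
    unfolding piecewise_syndetic_def
    by (intro exI[of _ G] exI[of _ "\<lambda>V. ?W (G V)"] conjI)
qed

lemma piecewise_syndetic_iff:
  assumes "F \<noteq> bot" "mult_closed (filter_closure F)"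
  shows "piecewise_syndetic F A \<longleftrightarrow> (\<exists>p \<in> smallest_ideal (filter_closure F). A \<in>\<^sub>F p)"
  using piecewise_syndetic_imp_smallest_ideal[OF assms]
    smallest_ideal_imp_piecewise_syndetic[OF assms] by blast

lemma quasi_central_iff:
  assumes "F \<noteq> bot" "mult_closed (filter_closure F)"
  shows "quasi_central F A \<longleftrightarrow>
    (\<exists>p \<in> filter_closure (Sup (smallest_ideal (filter_closure F))). p \<odot> p = p \<and> A \<in>\<^sub>F p)"
  unfolding quasi_central_def
    beta_closure_of[OF smallest_ideal_subset_ultrafilters[OF assms]] ..

text \<open>\<open>A\<close> determines a neighbourhood of \<open>p\<close>, which meets the
  smallest ideal itself, where piecewise syndeticity is detected.\<close>

lemma closure_smallest_ideal_imp_piecewise_syndetic: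
  assumes "F \<noteq> bot" "mult_closed (filter_closure F)"
    and p: "p \<in> filter_closure (Sup (smallest_ideal (filter_closure F)))" and A: "A \<in>\<^sub>F p"
  shows "piecewise_syndetic F A"
proof -
  have "ultrafilter p" "p \<le> Sup (smallest_ideal (filter_closure F))"
    using p by (auto simp: filter_closure_def)
  then show ?thesis
    using A ultrafilter_le_Sup_iff[OF smallest_ideal_subset_ultrafilters[OF assms(1,2)]]
    unfolding piecewise_syndetic_iff[OF assms(1,2)] by blast
qed


section \<open>Trees and directed families\<close>

text \<open>Subsequences stand for the index sets of \<open>FS_tree_in\<close>, which avoids
  arithmetic with positions.\<close>

definition finite_products :: "'a::semigroup_mult list \<Rightarrow> 'a set"
  where "finite_products g = semigroup_prod ` {xs. subseq xs g \<and> xs \<noteq> []}"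

lemma finite_productsI: "subseq xs g \<Longrightarrow> xs \<noteq> [] \<Longrightarrow> semigroup_prod xs \<in> finite_products g"
  by (auto simp: finite_products_def)

lemma finite_productsE:
  assumes "y \<in> finite_products g"
  obtains xs where "subseq xs g" "xs \<noteq> []" "y = semigroup_prod xs"
  using assms by (auto simp: finite_products_def)

lemma finite_finite_products: "finite (finite_products g)"
proof -
  have "{xs. subseq xs g \<and> xs \<noteq> []} \<subseteq> set (subseqs g)"
    by auto
  then show ?thesis
    unfolding finite_products_def by (meson List.finite_set finite_imageI finite_subset)
qed

lemma finite_products_Nil: "finite_products [] = {}"
  by (auto simp: finite_products_def)

lemma finite_products_single: "finite_products [x] = {x}"
proof -
  have "{xs. subseq xs [x] \<and> xs \<noteq> []} = {[x]}"
    by (auto simp flip: in_set_subseqs)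
  then show ?thesis
    by (simp add: finite_products_def)
qed

lemma semigroup_prod_append:
  "xs \<noteq> [] \<Longrightarrow> ys \<noteq> [] \<Longrightarrow> semigroup_prod (xs @ ys) = semigroup_prod xs * semigroup_prod ys"
  by (induction xs) (auto simp: mult.assoc)

text \<open>A subsequence of \<open>f @ h\<close> is one of \<open>f\<close> followed by one of
  \<open>h\<close>, and either may be empty, which accounts for the three parts.\<close>

lemma finite_products_append:
  "finite_products (f @ h) = finite_products f \<union> finite_products h \<union>
    {a * b | a b. a \<in> finite_products f \<and> b \<in> finite_products h}" (is "?L = ?R")
proof
  show "?L \<subseteq> ?R"
  proof
    fix y assume "y \<in> ?L"
    then obtain zs where zs: "subseq zs (f @ h)" "zs \<noteq> []" "y = semigroup_prod zs"
      by (rule finite_productsE)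
    then obtain xs ys where xy: "zs = xs @ ys" "subseq xs f" "subseq ys h"
      by (auto simp: subseq_append_iff)
    consider "xs = []" | "ys = []" | "xs \<noteq> []" "ys \<noteq> []" by blast
    then show "y \<in> ?R"
    proof cases
      case 1
      then show ?thesis
        using zs xy finite_productsI[of ys h] by simp
    next
      case 2
      then show ?thesis
        using zs xy finite_productsI[of xs f] by simp
    next
      case 3
      then have "y = semigroup_prod xs * semigroup_prod ys"
        using zs(3) xy(1) by (simp add: semigroup_prod_append)
      then show ?thesis
        using finite_productsI[OF xy(2) 3(1)] finite_productsI[OF xy(3) 3(2)] by blast
    qed
  qed
  have left: "a \<in> ?L" if "a \<in> finite_products f" for a
  proof -
    obtain xs where "subseq xs f" "xs \<noteq> []" "a = semigroup_prod xs"
      using \<open>a \<in> finite_products f\<close> by (rule finite_productsE)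
    then show ?thesis
      by (simp add: finite_productsI list_emb_prefix)
  qed
  have right: "b \<in> ?L" if "b \<in> finite_products h" for b
  proof -
    obtain ys where "subseq ys h" "ys \<noteq> []" "b = semigroup_prod ys"
      using \<open>b \<in> finite_products h\<close> by (rule finite_productsE)
    then show ?thesis
      by (simp add: finite_productsI list_emb_append2)
  qed
  have "a * b \<in> ?L" if "a \<in> finite_products f" "b \<in> finite_products h" for a b
  proof -
    obtain xs where "subseq xs f" "xs \<noteq> []" "a = semigroup_prod xs"
      using \<open>a \<in> finite_products f\<close> by (rule finite_productsE)
    moreover obtain ys where "subseq ys h" "ys \<noteq> []" "b = semigroup_prod ys"
      using \<open>b \<in> finite_products h\<close> by (rule finite_productsE)
    ultimately show ?thesis
      using finite_productsI[of "xs @ ys" "f @ h"]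
      by (simp add: semigroup_prod_append list_emb_append_mono)
  qed
  with left right show "?R \<subseteq> ?L" by blast
qed

lemma map_nth_sorted_list_of_set:
  assumes "H \<subseteq> {..<length g}"
  shows "map (\<lambda>t. g ! t) (sorted_list_of_set H) = nths g H"
proof -
  have "H = set (filter (\<lambda>i. i \<in> H) [0..<length g])"
    using assms by auto
  then have "sorted_list_of_set H = filter (\<lambda>i. i \<in> H) [0..<length g]"
    by (metis distinct_filter distinct_upt sorted_list_of_set.idem_if_sorted_distinct
        sorted_upt sorted_wrt_filter)
  moreover have "zip g [0..<length g] = map (\<lambda>i. (g ! i, i)) [0..<length g]"
    by (rule nth_equalityI) auto
  ultimately show ?thesis
    by (simp add: nths_def filter_map comp_def)
qed

text \<open>Index sets beyond \<open>f\<close> select nothing from \<open>f\<close>; shifted down by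
  \<open>length f\<close> they select subsequences of \<open>h\<close>.\<close>

lemma finite_products_eq_indexed:
  "{semigroup_prod (map (\<lambda>t. (f @ h) ! t) (sorted_list_of_set H)) | H.
      H \<noteq> {} \<and> H \<subseteq> {..<length (f @ h)} - {..<length f}} = finite_products h"
    (is "?L = _")
proof -
  have eq: "map (\<lambda>t. (f @ h) ! t) (sorted_list_of_set H) = nths h {j. j + length f \<in> H}"
    if "H \<subseteq> {..<length (f @ h)} - {..<length f}" for H
  proof -
    have "set (nths f H) = {}"
      using that by (auto simp: set_nths)
    then have "nths f H = []" by simp
    moreover have "H \<subseteq> {..<length (f @ h)}"
      using that by blast
    ultimately show ?thesis
      by (simp only: map_nth_sorted_list_of_set nths_append append_Nil)
  qed
  show ?thesis
  proof
    show "?L \<subseteq> finite_products h"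
    proof
      fix y assume "y \<in> ?L"
      then obtain H where H: "y = semigroup_prod (map (\<lambda>t. (f @ h) ! t) (sorted_list_of_set H))"
        "H \<noteq> {}" "H \<subseteq> {..<length (f @ h)} - {..<length f}" by blast
      from H(3) have "finite H"
        using finite_subset by blast
      then have "map (\<lambda>t. (f @ h) ! t) (sorted_list_of_set H) \<noteq> []"
        using H(2) by simp
      then show "y \<in> finite_products h"
        using H(1) unfolding eq[OF H(3)] finite_products_def subseq_conv_nths by blast
    qed
    show "finite_products h \<subseteq> ?L"
    proof
      fix y assume "y \<in> finite_products h"
      then obtain N where N: "y = semigroup_prod (nths h N)" "nths h N \<noteq> []"
        by (auto simp: finite_products_def subseq_conv_nths)
      \<comment> \<open>\<open>N\<close> may hold positions beyond the end of \<open>h\<close>;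
        besides shifting, \<open>H\<close> cuts these off.\<close>
      define H where "H = {i. length f \<le> i \<and> i < length (f @ h) \<and> i - length f \<in> N}"
      have H: "H \<subseteq> {..<length (f @ h)} - {..<length f}"
        by (auto simp: H_def)
      have "nths h {j. j + length f \<in> H} = nths h N"
        unfolding nths_def H_def by (intro arg_cong[of _ _ "map fst"] filter_cong)
          (auto dest: set_zip_rightD)
      then have "y = semigroup_prod (map (\<lambda>t. (f @ h) ! t) (sorted_list_of_set H))" "H \<noteq> {}"
        using N eq[OF H] by auto
      with H show "y \<in> ?L" by blast
    qed
  qed
qed

lemma FS_tree_in_iff:
  "FS_tree_in A T \<longleftrightarrow>
    tree_in A T \<and> (\<forall>f\<in>T. succs T f = (\<Union>h\<in>{h. f @ h \<in> T}. finite_products h))"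
proof -
  have "{semigroup_prod (map (\<lambda>t. g ! t) (sorted_list_of_set H)) | g H.
      g \<in> T \<and> prefix f g \<and> H \<noteq> {} \<and> H \<subseteq> {..<length g} - {..<length f}} =
    (\<Union>h\<in>{h. f @ h \<in> T}. finite_products h)" for f
    unfolding finite_products_eq_indexed[of f, symmetric] prefix_def by blast
  then show ?thesis
    unfolding FS_tree_in_def by simp
qed

section \<open>Trees with large successor sets\<close>

lemma tree_in_succs_subset: "tree_in A T \<Longrightarrow> succs T f \<subseteq> A"
  by (auto simp: tree_in_def succs_def)

text \<open>If \<open>y\<close> is a product along some \<open>h\<close> above
  \<open>f @ [x]\<close>, then \<open>x * y\<close> is a product along \<open>[x] @ h\<close> above
  \<open>f\<close>.\<close>

lemma FS_tree_in_imp_star_tree_in: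
  assumes "FS_tree_in A T"
  shows "star_tree_in A T"
  unfolding star_tree_in_def
proof (intro conjI ballI subsetI)
  fix f x y assume f: "f \<in> T" "x \<in> succs T f" "y \<in> succs T (f @ [x])"
  then have "f @ [x] \<in> T" by (simp add: succs_def)
  with f(3) obtain h where h: "f @ [x] @ h \<in> T" "y \<in> finite_products h"
    using assms unfolding FS_tree_in_iff by auto
  then have "x * y \<in> finite_products ([x] @ h)"
    unfolding finite_products_append by (auto simp: finite_products_single)
  then show "y \<in> left_quot x (succs T f)"
    using assms f(1) h(1) unfolding FS_tree_in_iff left_quot_def by auto
qed (use assms in \<open>simp add: FS_tree_in_def\<close>)

text \<open>Appending \<open>x\<close> to \<open>f\<close> adds only the products \<open>x\<close>
  and \<open>a * x\<close> with \<open>a\<close> a product of \<open>f\<close>. So the successors of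
  \<open>f\<close> form a finite intersection of \<open>A'\<close> and sets
  \<open>left_quot a A'\<close>, all of them in \<open>p\<close>.\<close>

lemma FS_tree_of_idempotent:
  assumes "p \<odot> p = p" "A \<in>\<^sub>F p"
  shows "\<exists>T. FS_tree_in A T \<and> (\<forall>f\<in>T. succs T f \<in>\<^sub>F p)"
proof -
  define A' where "A' = {x \<in> A. left_quot x A \<in>\<^sub>F p}"
  define T where "T = {g. finite_products g \<subseteq> A'}"
  have idem: "{x. left_quot x B \<in>\<^sub>F p} \<in>\<^sub>F p" if "B \<in>\<^sub>F p" for B
    using that assms(1) by (metis mem_beta_mult_iff)
  have A': "A' \<in>\<^sub>F p"
    using idem[OF assms(2)] assms(2) by (simp add: A'_def eventually_conj_iff)
  \<comment> \<open>As \<open>left_quot (x * y) A = left_quot y (left_quot x A)\<close>, idempotence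
    applied to \<open>left_quot x A\<close> carries the second condition in \<open>A'\<close> over
    to \<open>x * y\<close> for \<open>p\<close>-most \<open>y\<close>.\<close>
  have shift: "left_quot x A' \<in>\<^sub>F p" if "x \<in> A'" for x
  proof -
    have "{y. left_quot y (left_quot x A) \<in>\<^sub>F p} \<in>\<^sub>F p" "left_quot x A \<in>\<^sub>F p"
      using that idem[of "left_quot x A"] by (simp_all add: A'_def)
    then show ?thesis
      by (simp add: A'_def left_quot_def mult.assoc eventually_conj_iff)
  qed
  have snoc: "f @ [x] \<in> T \<longleftrightarrow> f \<in> T \<and> x \<in> A' \<and> (\<forall>a\<in>finite_products f. a * x \<in> A')" for f x
    by (auto simp: T_def finite_products_append finite_products_single)
  have "tree_in A T"
    unfolding tree_in_def
  proof (intro conjI ballI impI)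
    show "T \<noteq> {}"
      by (auto simp: T_def intro!: exI[of _ "[]"] simp: finite_products_Nil)
    fix f assume f: "f \<in> T"
    show "set f \<subseteq> A"
    proof
      fix x assume "x \<in> set f"
      then obtain ys zs where "f = (ys @ [x]) @ zs"
        by (auto dest: split_list)
      then have "x \<in> finite_products f"
        by (simp only: finite_products_append finite_products_single) blast
      then show "x \<in> A"
        using f by (auto simp: T_def A'_def)
    qed
    show "butlast f \<in> T" if "f \<noteq> []"
      using f snoc[of "butlast f" "last f"] that by simp
  qed
  moreover have "succs T f = (\<Union>h\<in>{h. f @ h \<in> T}. finite_products h)" if f: "f \<in> T" for f
  proof
    show "succs T f \<subseteq> (\<Union>h\<in>{h. f @ h \<in> T}. finite_products h)"
      using finite_products_single by (fastforce simp: succs_def)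
    \<comment> \<open>A product \<open>b\<close> along \<open>h\<close> and all \<open>a * b\<close>
      with \<open>a\<close> a product of \<open>f\<close> are products of \<open>f @ h\<close>, so
      they lie in \<open>A'\<close> and \<open>f\<close> may be followed by
      \<open>b\<close>.\<close>
    show "(\<Union>h\<in>{h. f @ h \<in> T}. finite_products h) \<subseteq> succs T f"
      using f unfolding succs_def snoc by (auto simp: T_def finite_products_append) blast
  qed
  moreover have "succs T f \<in>\<^sub>F p" if f: "f \<in> T" for f
  proof -
    have "\<forall>a\<in>finite_products f. left_quot a A' \<in>\<^sub>F p"
      using f shift by (auto simp: T_def)
    then have "\<forall>\<^sub>F x in p. \<forall>a\<in>finite_products f. x \<in> left_quot a A'"
      by (simp add: eventually_ball_finite_distrib finite_finite_products)
    with A' show ?thesis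
      by eventually_elim (use f in \<open>simp add: succs_def snoc left_quot_def\<close>)
  qed
  ultimately show ?thesis
    unfolding FS_tree_in_iff by blast
qed

text \<open>Appending \<open>x\<close> to every node of \<open>H\<close> is the source of the
  quotient condition, both for the directed family and for the sequence.\<close>

lemma star_tree_shift:
  assumes "star_tree_in A T" "H \<subseteq> T" "x \<in> (\<Inter>f\<in>H. succs T f)"
  shows "(\<lambda>f. f @ [x]) ` H \<subseteq> T"
    and "(\<Inter>f\<in>(\<lambda>f. f @ [x]) ` H. succs T f) \<subseteq> left_quot x (\<Inter>f\<in>H. succs T f)"
proof -
  show "(\<lambda>f. f @ [x]) ` H \<subseteq> T"
    using assms(3) by (auto simp: succs_def)
  have "succs T (f @ [x]) \<subseteq> left_quot x (succs T f)" if "f \<in> H" for f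
    using assms that unfolding star_tree_in_def by blast
  then show "(\<Inter>f\<in>(\<lambda>f. f @ [x]) ` H. succs T f) \<subseteq> left_quot x (\<Inter>f\<in>H. succs T f)"
    unfolding left_quot_def by blast
qed

text \<open>With finite sets of nodes as indices, a common lower bound comes from the union of two
  indices.\<close>

lemma good_family_of_star_tree:
  assumes star: "star_tree_in A T" and ps: "succs_piecewise_syndetic F T"
  shows "good_family F A {H. finite H \<and> H \<noteq> {} \<and> H \<subseteq> T} (\<lambda>H. \<Inter>f\<in>H. succs T f)"
    (is "good_family F A ?I ?C")
  unfolding good_family_def downward_directed_def
proof (intro conjI ballI)
  have tree: "tree_in A T"
    using star by (simp add: star_tree_in_def)
  then obtain f where "f \<in> T"
    by (auto simp: tree_in_def)
  then have "{f} \<in> ?I" by simp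
  then show "?I \<noteq> {}" by blast
  fix H assume H: "H \<in> ?I"
  then show "?C H \<subseteq> A"
    using tree_in_succs_subset[OF tree] by blast
  show "piecewise_syndetic F (?C H)"
    using H ps unfolding succs_piecewise_syndetic_def by blast
  show "\<exists>G\<in>?I. ?C G \<subseteq> left_quot x (?C H)" if "x \<in> ?C H" for x
    using star_tree_shift[OF star _ that] H
    by (intro bexI[of _ "(\<lambda>f. f @ [x]) ` H"]) auto
  show "\<exists>M\<in>?I. ?C M \<subseteq> ?C H \<inter> ?C G" if "G \<in> ?I" for G
    using H that by (intro bexI[of _ "H \<union> G"]) auto
qed

lemma good_family_of_good_sequence:
  assumes "good_sequence F A C"
  shows "good_family F A {1..} C"
  unfolding good_family_def downward_directed_def
proof (intro conjI ballI)
  fix i j :: nat assume "i \<in> {1..}" "j \<in> {1..}"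
  then have "C (max i j) \<subseteq> C i \<inter> C j"
    using assms by (auto simp: good_sequence_def monotone_on_def)
  then show "\<exists>k\<in>{1..}. C k \<subseteq> C i \<inter> C j"
    using \<open>i \<in> {1..}\<close> by (intro bexI[of _ "max i j"]) auto
qed (use assms in \<open>auto simp: good_sequence_def Bex_def\<close>)

text \<open>Countability passes from the semigroup to lists over it, so the nodes can be enumerated,
  and every finite set of nodes lies in an initial segment.\<close>

lemma good_sequence_of_star_tree:
  fixes T :: "'a::semigroup_mult list set"
  assumes "countable (UNIV :: 'a set)"
    and star: "star_tree_in A T" and ps: "succs_piecewise_syndetic F T"
  shows "\<exists>C. good_sequence F A C"
proof -
  have tree: "tree_in A T"
    using star by (simp add: star_tree_in_def)
  have "countable T"
    using assms(1) by (metis countable_lists countable_subset lists_UNIV subset_UNIV)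
  moreover have "T \<noteq> {}"
    using tree by (simp add: tree_in_def)
  ultimately have T: "range (from_nat_into T) = T"
    by (simp add: range_from_nat_into)
  \<comment> \<open>Index \<open>0\<close> is included, so \<open>C n\<close> is never an empty
    intersection.\<close>
  define C where "C n = (\<Inter>f\<in>from_nat_into T ` {..n}. succs T f)" for n
  have fin: "finite (from_nat_into T ` {..n})" "from_nat_into T ` {..n} \<noteq> {}"
    "from_nat_into T ` {..n} \<subseteq> T" for n
    using T by auto
  have mono: "C m \<subseteq> C n" if "n \<le> m" for m n
    using that by (auto simp: C_def)
  have "\<exists>m\<ge>1. C m \<subseteq> left_quot x (C n)" if x: "x \<in> C n" for x n
  proof -
    let ?H = "(\<lambda>f. f @ [x]) ` from_nat_into T ` {..n}"
    have H: "?H \<subseteq> T" "(\<Inter>f\<in>?H. succs T f) \<subseteq> left_quot x (C n)"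
      using star_tree_shift[OF star fin(3) x[unfolded C_def]] unfolding C_def by auto
    have "finite ?H" by simp
    moreover have "?H \<subseteq> range (from_nat_into T)"
      using H(1) T by simp
    ultimately obtain M where M: "finite M" "?H = from_nat_into T ` M"
      by (meson finite_subset_image)
    \<comment> \<open>All of \<open>?H\<close> is enumerated by the largest element of
      \<open>M\<close>; inserting \<open>1\<close> keeps the index in the range of the sequence and
      covers an empty \<open>M\<close>.\<close>
    then have "M \<subseteq> {..Max (insert 1 M)}"
      by (auto intro: Max_ge)
    then have "C (Max (insert 1 M)) \<subseteq> (\<Inter>f\<in>?H. succs T f)"
      unfolding M(2) C_def by blast
    then have "C (Max (insert 1 M)) \<subseteq> left_quot x (C n)"
      using H(2) by (rule order_trans)
    moreover have "Max (insert 1 M) \<ge> 1"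
      using M(1) by (auto intro: Max_ge)
    ultimately show ?thesis
      by (intro exI conjI)
  qed
  moreover have "piecewise_syndetic F (C n)" for n
    using ps[unfolded succs_piecewise_syndetic_def, rule_format, of "from_nat_into T ` {..n}"] fin[of n]
    by (simp add: C_def)
  moreover have "C n \<subseteq> A" for n
  proof -
    have "C n \<subseteq> succs T (from_nat_into T n)"
      by (auto simp: C_def)
    then show ?thesis
      using tree_in_succs_subset[OF tree] by (rule order_trans)
  qed
  ultimately have "good_sequence F A C"
    using mono by (simp add: good_sequence_def monotone_on_def)
  then show ?thesis by blast
qed

section \<open>From a directed family back to an idempotent\<close>

text \<open>Piecewise syndeticity and directedness make the closed set
  \<open>filter_closure M\<close> below nonempty, and the quotient condition helps to make it
  multiplicative, so Ellis-Numakura applies.\<close>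

lemma quasi_central_of_good_family:
  assumes "F \<noteq> bot" and T: "mult_closed (filter_closure F)" and "good_family F A I C"
  shows "quasi_central F A"
proof -
  let ?K = "smallest_ideal (filter_closure F)"
  have dir: "I \<noteq> {}" "\<And>i j. i \<in> I \<Longrightarrow> j \<in> I \<Longrightarrow> \<exists>k\<in>I. C k \<subseteq> C i \<inter> C j"
    and sub: "\<And>i. i \<in> I \<Longrightarrow> C i \<subseteq> A"
    and quot: "\<And>i x. i \<in> I \<Longrightarrow> x \<in> C i \<Longrightarrow> \<exists>j\<in>I. C j \<subseteq> left_quot x (C i)"
    and ps: "\<And>i. i \<in> I \<Longrightarrow> piecewise_syndetic F (C i)"
    using assms(3) unfolding good_family_def downward_directed_def by auto
  have lower: "\<exists>k\<in>I. C k \<subseteq> (\<Inter>i\<in>X. C i)" if "finite X" "X \<subseteq> I" for X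
    using that
  proof induction
    case empty
    then show ?case using dir(1) by auto
  next
    case (insert i X)
    then obtain k where "k \<in> I" "C k \<subseteq> (\<Inter>i\<in>X. C i)"
      by auto
    moreover from this obtain l where "l \<in> I" "C l \<subseteq> C i \<inter> C k"
      using dir(2)[of i k] insert.prems by auto
    ultimately show ?case
      by (intro bexI[of _ l]) auto
  qed
  have K_uf: "?K \<subseteq> Collect ultrafilter"
    by (rule smallest_ideal_subset_ultrafilters[OF assms(1) T])
  have K_ideal: "two_sided_ideal (filter_closure F) ?K"
    by (rule two_sided_ideal_smallest_ideal[OF assms(1) T])
  \<comment> \<open>A single \<open>C k\<close> lies inside the intersection and belongs to some
    member of the smallest ideal, so the complement cannot be common to all of them.\<close>
  have *: "\<not> - (\<Inter>i\<in>X. C i) \<in>\<^sub>F Sup ?K" if X: "finite X" "X \<subseteq> I" for X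
  proof
    assume compl: "- (\<Inter>i\<in>X. C i) \<in>\<^sub>F Sup ?K"
    obtain k where k: "k \<in> I" "C k \<subseteq> (\<Inter>i\<in>X. C i)"
      using lower[OF X] by blast
    obtain p where p: "p \<in> ?K" "C k \<in>\<^sub>F p"
      using ps[OF k(1)] unfolding piecewise_syndetic_iff[OF assms(1) T] by blast
    from p(2) have "(\<Inter>i\<in>X. C i) \<in>\<^sub>F p"
      by (rule eventually_mono) (use k(2) in blast)
    moreover have "- (\<Inter>i\<in>X. C i) \<in>\<^sub>F p"
      using compl p(1) unfolding eventually_Sup by blast
    ultimately show False
      using p(1) K_uf ultrafilter_Compl_iff by blast
  qed
  define M where "M = inf (Sup ?K) (INF i\<in>I. principal (C i))"
  have M: "p \<in> filter_closure M \<longleftrightarrow> ultrafilter p \<and> p \<le> Sup ?K \<and> (\<forall>i\<in>I. C i \<in>\<^sub>F p)" for p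
    by (auto simp: M_def filter_closure_def le_INF_iff le_principal)
  obtain p where "ultrafilter p" "p \<le> Sup ?K" "\<forall>i\<in>I. C i \<in>\<^sub>F p"
    by (rule ultrafilter_inf_INF_principal_exists[OF *])
  then have "p \<in> filter_closure M"
    by (simp add: M)
  then have "M \<noteq> bot"
    by (auto simp: filter_closure_def ultrafilter_def bot_unique)
  have "Sup ?K \<le> F"
    using K_ideal by (auto simp: two_sided_ideal_def filter_closure_def intro!: Sup_least)
  have "mult_closed (filter_closure M)"
    unfolding mult_closed_def
  proof (intro ballI)
    fix p q assume p: "p \<in> filter_closure M" and q: "q \<in> filter_closure M"
    have uf: "ultrafilter p" "ultrafilter q"
      using p q by (simp_all add: M)
    have "q \<le> F"
      using q \<open>Sup ?K \<le> F\<close> unfolding M by (blast intro: order_trans)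
    with uf(2) have "q \<in> filter_closure F"
      by (simp add: filter_closure_def)
    \<comment> \<open>Right multiplication by \<open>q\<close> maps \<open>?K\<close> into itself.
      Hence \<open>{x. left_quot x B \<in>\<^sub>F q}\<close> is common to all of \<open>?K\<close>,
      and \<open>p\<close>, being below \<open>Sup ?K\<close>, inherits it.\<close>
    have "p \<odot> q \<le> Sup ?K"
      unfolding filter_le_iff_mem
    proof (intro allI impI)
      fix B assume B: "B \<in>\<^sub>F Sup ?K"
      have "B \<in>\<^sub>F r \<odot> q" if "r \<in> ?K" for r
        using that B K_ideal \<open>q \<in> filter_closure F\<close>
        unfolding two_sided_ideal_def eventually_Sup by blast
      then have "{x. left_quot x B \<in>\<^sub>F q} \<in>\<^sub>F Sup ?K"
        unfolding mem_beta_mult_iff eventually_Sup by blast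
      then show "B \<in>\<^sub>F p \<odot> q"
        using p unfolding mem_beta_mult_iff M le_filter_def by blast
    qed
    \<comment> \<open>For every \<open>x\<close> in \<open>C i\<close>, a member of
      \<open>p\<close>, the quotient contains some \<open>C j\<close>, which is in
      \<open>q\<close>.\<close>
    moreover have "C i \<in>\<^sub>F p \<odot> q" if i: "i \<in> I" for i
      unfolding mem_beta_mult_iff
    proof (rule eventually_mono)
      show "C i \<in>\<^sub>F p"
        using p i by (simp add: M)
      fix x assume "x \<in> C i"
      then obtain j where j: "j \<in> I" "C j \<subseteq> left_quot x (C i)"
        using quot i by blast
      have "C j \<in>\<^sub>F q"
        using q j(1) by (simp add: M)
      then have "left_quot x (C i) \<in>\<^sub>F q"
        by (rule eventually_mono) (use j(2) in blast)
      then show "x \<in> {x. left_quot x (C i) \<in>\<^sub>F q}" by simp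
    qed
    ultimately show "p \<odot> q \<in> filter_closure M"
      using uf by (simp add: M ultrafilter_beta_mult)
  qed
  with \<open>M \<noteq> bot\<close> obtain e where e: "e \<in> filter_closure M" "e \<odot> e = e"
    by (rule idempotent_exists)
  obtain i where i: "i \<in> I"
    using dir(1) by blast
  then have "C i \<in>\<^sub>F e"
    using e(1) by (simp add: M)
  then have "A \<in>\<^sub>F e"
    by (rule eventually_mono) (use sub[OF i] in blast)
  moreover have "e \<in> filter_closure (Sup ?K)"
    using e(1) unfolding M by (simp add: filter_closure_def)
  ultimately show ?thesis
    unfolding quasi_central_iff[OF assms(1) T] using e(2) by blast
qed


theorem theorem5p8:
  fixes T :: "'a::semigroup_mult filter set"
    and F :: "'a filter"
    and A :: "'a set"
  assumes "closed_subsemigroup T"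
    and "F \<noteq> bot"
    and "filter_closure F = T"
  shows
    "(quasi_central F A \<longleftrightarrow>
        (\<exists>\<T>. FS_tree_in A \<T> \<and> succs_piecewise_syndetic F \<T>)) \<and>
     (quasi_central F A \<longleftrightarrow>
        (\<exists>\<T>. star_tree_in A \<T> \<and> succs_piecewise_syndetic F \<T>)) \<and>
     (quasi_central F A \<longleftrightarrow>
        (\<exists>(I :: 'a set set) C. good_family F A I C)) \<and>
     ((\<exists>C. good_sequence F A C) \<longrightarrow> quasi_central F A) \<and>
     (countable (UNIV :: 'a set) \<longrightarrow>
        (quasi_central F A \<longleftrightarrow> (\<exists>C. good_sequence F A C)))"
proof -
  have T: "mult_closed (filter_closure F)"
    using assms(1,3) by (simp add: closed_subsemigroup_def mult_closed_def)
  have ab: "\<exists>\<T>. FS_tree_in A \<T> \<and> succs_piecewise_syndetic F \<T>" if qc: "quasi_central F A"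
  proof -
    obtain p where p: "p \<in> filter_closure (Sup (smallest_ideal (filter_closure F)))"
      "p \<odot> p = p" "A \<in>\<^sub>F p"
      using qc unfolding quasi_central_iff[OF assms(2) T] by blast
    obtain \<T> where \<T>: "FS_tree_in A \<T>" "\<forall>f\<in>\<T>. succs \<T> f \<in>\<^sub>F p"
      using FS_tree_of_idempotent[OF p(2,3)] by blast
    \<comment> \<open>Finite intersections of the successor sets stay in \<open>p\<close>, and every
      member of \<open>p\<close> is piecewise syndetic because \<open>p\<close> is in the closure of
      the smallest ideal.\<close>
    have "piecewise_syndetic F (\<Inter>f\<in>H. succs \<T> f)" if "finite H" "H \<subseteq> \<T>" for H
    proof (rule closure_smallest_ideal_imp_piecewise_syndetic[OF assms(2) T p(1)])
      show "(\<Inter>f\<in>H. succs \<T> f) \<in>\<^sub>F p"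
        using that \<T>(2) by (intro finite_Inter_mem) auto
    qed
    with \<T>(1) show ?thesis
      unfolding succs_piecewise_syndetic_def by blast
  qed
  have bc: "\<exists>\<T>. star_tree_in A \<T> \<and> succs_piecewise_syndetic F \<T>"
    if "\<exists>\<T>. FS_tree_in A \<T> \<and> succs_piecewise_syndetic F \<T>"
    using that FS_tree_in_imp_star_tree_in by blast
  have cd: "\<exists>(I :: 'a set set) C. good_family F A I C"
    if "\<exists>\<T>. star_tree_in A \<T> \<and> succs_piecewise_syndetic F \<T>"
    \<comment> \<open>The family is first indexed by sets of lists; reindexing by its own members
      gives indices of type \<open>'a set\<close>.\<close>
    using that good_family_of_star_tree good_family_reindex by blast
  have da: "quasi_central F A" if "\<exists>(I :: 'a set set) C. good_family F A I C"
    using that quasi_central_of_good_family[OF assms(2) T] by blast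
  have ea: "quasi_central F A" if "\<exists>C. good_sequence F A C"
    using that good_family_of_good_sequence quasi_central_of_good_family[OF assms(2) T] by blast
  have ce: "\<exists>C. good_sequence F A C"
    if "countable (UNIV :: 'a set)" "\<exists>\<T>. star_tree_in A \<T> \<and> succs_piecewise_syndetic F \<T>"
    using that good_sequence_of_star_tree by blast
  \<comment> \<open>(a), (b), (c), (d) form a cycle; (e) leads to (a) as a special directed family,
    and (c) leads to (e) in the countable case.\<close>
  show ?thesis
    using ab bc cd da ea ce by argo
qed

end
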